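(* Let $f\colon\mathbb{R}^d\to\mathbb{R}$ be a symmetric convex function, let $\bar x\in\mathbb{R}^d\setminus\{0\}$, and define $g(x):=f_\lambda(xx^T-\bar x\bar x^T)$ for $x\in\mathbb{R}^d$. Suppose that $x$ is stationary for $g$, that is, $Vx=0$ for some $V\in\partial f_\lambda(xx^T-\bar x\bar x^T)$, and fix such a $V$. Then one of the following conditions holds: 1. $g(x)\le g(\bar x)$; 2. $x=0$; 3. $\langle x,\bar x\rangle=0$ and $\lambda_1(V)=0$. Moreover, if $\bar x$ minimizes $g$, then a point $x$ is stationary for $g$ if and only if $x$ satisfies condition 1, condition 2, or condition 3 (the latter for some $V\in\partial f_\lambda(xx^T-\bar x\bar x^T)$).
   Context: A function $f\colon\mathbb{R}^d\to\mathbb{R}$ is symmetric if $f(\sigma x)=f(x)$ for all coordinate permutations $\sigma$. For a real symmetric $d\times d$ matrix $X$, $\lambda(X)=(\lambda_1(X),\dots,\lambda_d(X))$ denotes its eigenvalues in nonincreasing order, and $f_\lambda(X):=f(\lambda(X))$. The space of real symmetric $d\times d$ matrices carries the trace inner product $\langle X,Y\rangle=\mathrm{Tr}(XY)$; for convex symmetric $f$, $f_\lambda$ is convex, and $\partial f_\lambda$ is its convex-analytic subdifferential. A point $x$ is stationary for $g$ if $0\in\partial g(x)$ (limiting subdifferential, i.e. the set of limits of Fréchet subgradients $v_i$ at points $x_i\to x$ with $g(x_i)\to g(x)$). *)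

theory Defs
  imports "HOL-Analysis.Analysis" "HOL-Computational_Algebra.Polynomial"
begin

(* R^d is modelled as real ^ 'n with d = CARD('n). The index type carries a linear order so
   that "the i-th largest eigenvalue" makes sense; the first index is Min UNIV. *)

definition symmetric_function :: "(real ^ 'n \<Rightarrow> 'b) \<Rightarrow> bool" where
  "symmetric_function f \<longleftrightarrow> (\<forall>\<sigma> x. \<sigma> permutes UNIV \<longrightarrow> f (\<chi> i. x $ \<sigma> i) = f x)"

definition charpoly :: "real ^ 'n ^ 'n \<Rightarrow> real poly" where
  "charpoly X = det (mat [:0, 1:] - (\<chi> i j. [:X $ i $ j:]))"

(* The roots of the characteristic polynomial with multiplicity, in nonincreasing order;
   card {j. j < i} is the position of i in the index order, counted from 0.
   Only meaningful when the characteristic polynomial splits over the reals,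
   in particular for symmetric X. *)
definition eigvals :: "real ^ 'n::{finite,linorder} ^ 'n::{finite,linorder} \<Rightarrow> real ^ 'n::{finite,linorder}" where
  "eigvals X = (\<chi> i. rev (sorted_list_of_multiset (proots (charpoly X))) ! card {j. j < i})"

definition spectral_function ::
    "(real ^ 'n::{finite,linorder} \<Rightarrow> real) \<Rightarrow> real ^ 'n::{finite,linorder} ^ 'n::{finite,linorder} \<Rightarrow> real" where
  "spectral_function f X = f (eigvals X)"

(* Convex-analytic subdifferential in the space of symmetric matrices with the trace inner
   product: both the subgradients V and the test points Y range over symmetric matrices. *)
definition sym_subdifferential ::
    "(real ^ 'n ^ 'n \<Rightarrow> real) \<Rightarrow> real ^ 'n ^ 'n \<Rightarrow> (real ^ 'n ^ 'n) set" where
  "sym_subdifferential F X =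
     {V. transpose V = V \<and>
         (\<forall>Y. transpose Y = Y \<longrightarrow> F Y \<ge> F X + trace (V ** (Y - X)))}"

definition outer_product :: "real ^ 'n \<Rightarrow> real ^ 'n \<Rightarrow> real ^ 'n ^ 'n" where
  "outer_product x y = (\<chi> i j. x $ i * y $ j)"

(* v is a Frechet subgradient of g at x if
   g y \<ge> g x + v \<bullet> (y - x) + o(norm (y - x)) as y tends to x. *)
definition frechet_subdifferential :: "('a::real_inner \<Rightarrow> real) \<Rightarrow> 'a \<Rightarrow> 'a set" where
  "frechet_subdifferential g x =
     {v. \<forall>\<epsilon>>0. \<forall>\<^sub>F y in at x. g y \<ge> g x + v \<bullet> (y - x) - \<epsilon> * norm (y - x)}"

definition limiting_subdifferential :: "('a::real_inner \<Rightarrow> real) \<Rightarrow> 'a \<Rightarrow> 'a set" where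
  "limiting_subdifferential g x =
     {v. \<exists>xs vs. xs \<longlonglongrightarrow> x \<and> (\<lambda>i::nat. g (xs i)) \<longlonglongrightarrow> g x \<and> vs \<longlonglongrightarrow> v \<and>
         (\<forall>i. vs i \<in> frechet_subdifferential g (xs i))}"

definition stationary :: "('a::real_inner \<Rightarrow> real) \<Rightarrow> 'a \<Rightarrow> bool" where
  "stationary g x \<longleftrightarrow> 0 \<in> limiting_subdifferential g x"

end

theory Submission
  imports Defs
begin

text \<open>
  Plane rotations give everything about spectral functions. Among the orthogonal conjugates of a
  symmetric \<open>Y\<close> whose diagonal does not decrease \<open>f\<close>, one with the largest sum of squared diagonal
  entries exists by compactness, and it is diagonal: rotating away an off-diagonal entry would
  enlarge that sum, and the old diagonal is a convex combination of the new one and a transposed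
  copy. So \<open>f (diag Y) \<le> f\<^sub>\<lambda> Y\<close>, and \<open>f\<^sub>\<lambda>\<close> is convex since it is a maximum of convex functions
  of this form.

  A Frechet subgradient \<open>v\<close> of \<open>g\<close> at \<open>y\<close> satisfies
  \<open>f\<^sub>\<lambda> (X y + y h\<^sup>T + h y\<^sup>T) \<ge> g y + v \<bullet> h\<close>, because \<open>X (y + t h)\<close> is the convex combination
  \<open>(1 - t) X y + t (X y + y h\<^sup>T + h y\<^sup>T + t h h\<^sup>T)\<close>. This passes to limits, and for \<open>v = 0\<close> separating
  the epigraph from a flat affine space produces \<open>V\<close> with \<open>V x = 0\<close>.

  For a subgradient \<open>V\<close> at \<open>X x\<close> the quantity \<open>T x \<bullet> V (T x) - T xbar \<bullet> V (T xbar)\<close> is maximal at the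
  identity among orthogonal \<open>T\<close>. If \<open>V x = 0\<close>, the first order condition makes \<open>xbar\<close> an
  eigenvector, with eigenvalue \<open>\<mu>\<close> say; testing the subgradient inequality at \<open>0\<close> gives condition 1
  when \<open>\<mu> \<ge> 0\<close>, and symmetry of \<open>V\<close> gives \<open>x \<bullet> xbar = 0\<close> when \<open>\<mu> < 0\<close>. If \<open>x\<close> and \<open>xbar\<close> are
  nonzero and orthogonal, reflections and rotations show that \<open>x\<close> maximizes the Rayleigh quotient
  of \<open>V\<close>, which links \<open>V x = 0\<close> to \<open>\<lambda>\<^sub>1 V = 0\<close> in both directions.
\<close>

section \<open>Orthogonal maps and eigenvalue vectors\<close>

lemma matrix_diff_ldistrib:
  fixes A :: "'a::ring_1 ^ 'n ^ 'm"
  shows "A ** (B - C) = A ** B - A ** C"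
  by (simp add: matrix_matrix_mult_def vec_eq_iff right_diff_distrib sum_subtractf)

lemma matrix_diff_rdistrib:
  fixes A :: "'a::ring_1 ^ 'n ^ 'm"
  shows "(A - B) ** C = A ** C - B ** C"
  by (simp add: matrix_matrix_mult_def vec_eq_iff left_diff_distrib sum_subtractf)

lemma conj_outer_product:
  fixes Q :: "real ^ 'n ^ 'n"
  shows "Q ** outer_product x y ** transpose Q = outer_product (Q *v x) (Q *v y)"
proof -
  have "(\<Sum>k\<in>UNIV. (\<Sum>l\<in>UNIV. Q $ i $ l * (x $ l * y $ k)) * Q $ j $ k) =
        (\<Sum>l\<in>UNIV. Q $ i $ l * x $ l) * (\<Sum>k\<in>UNIV. Q $ j $ k * y $ k)" for i j
    by (simp add: sum_distrib_left sum_distrib_right mult_ac)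
  then show ?thesis
    by (simp add: vec_eq_iff outer_product_def matrix_matrix_mult_def matrix_vector_mult_def
        transpose_def)
qed

lemma trace_mult_outer_product:
  fixes V :: "real ^ 'n ^ 'n"
  shows "trace (V ** outer_product x y) = y \<bullet> (V *v x)"
  by (simp add: trace_def outer_product_def matrix_matrix_mult_def matrix_vector_mult_def
      inner_vec_def sum_distrib_left mult_ac)

lemma inner_matrix_symmetric:
  fixes V :: "real ^ 'n ^ 'n"
  assumes "transpose V = V"
  shows "y \<bullet> (V *v z) = z \<bullet> (V *v y)"
  by (metis assms dot_lmul_matrix inner_commute vector_transpose_matrix)

lemma orthogonal_matrix_transpose_mult:
  fixes Q :: "real ^ 'n ^ 'n"
  assumes "orthogonal_matrix Q"
  shows "Q *v (transpose Q *v x) = x"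
  using assms by (metis matrix_vector_mul_assoc matrix_vector_mul_lid orthogonal_matrix_def)

text \<open>For orthonormal \<open>u\<close> and \<open>w\<close> this rotates their span by the
  angle \<open>t\<close> and fixes the orthogonal complement. Written as a perturbation of the
  identity, it avoids extending to a basis and displays its velocity at
  \<open>t = 0\<close>.\<close>

definition plane_rotation :: "'a::real_inner \<Rightarrow> 'a \<Rightarrow> real \<Rightarrow> 'a \<Rightarrow> 'a" where
  "plane_rotation u w t y =
     y + (cos t - 1) *\<^sub>R ((y \<bullet> u) *\<^sub>R u + (y \<bullet> w) *\<^sub>R w) + sin t *\<^sub>R ((y \<bullet> u) *\<^sub>R w - (y \<bullet> w) *\<^sub>R u)"

lemma orthogonal_transformation_plane_rotation:
  fixes u w :: "'a::euclidean_space"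
  assumes "u \<bullet> u = 1" "w \<bullet> w = 1" "u \<bullet> w = 0"
  shows "orthogonal_transformation (plane_rotation u w t)"
  unfolding orthogonal_transformation_def
proof (intro conjI allI)
  show "linear (plane_rotation u w t)"
    by (rule linearI) (simp_all add: plane_rotation_def algebra_simps)
  fix y z
  have wu: "w \<bullet> u = 0" using assms(3) by (simp add: inner_commute)
  define C S where "C = cos t" and "S = sin t"
  have CS: "C\<^sup>2 + S\<^sup>2 = 1" by (simp add: C_def S_def)
  have "plane_rotation u w t y \<bullet> plane_rotation u w t z = y \<bullet> z +
     (C\<^sup>2 + S\<^sup>2 - 1) * ((y \<bullet> u) * (z \<bullet> u) + (y \<bullet> w) * (z \<bullet> w))"
    unfolding plane_rotation_def C_def[symmetric] S_def[symmetric]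
    by (simp add: inner_add_left inner_add_right inner_diff_left
        inner_diff_right assms wu inner_commute[of u z] inner_commute[of w z] power2_eq_square algebra_simps)
  also have "C\<^sup>2 + S\<^sup>2 - 1 = 0" using CS by simp
  finally show "plane_rotation u w t y \<bullet> plane_rotation u w t z = y \<bullet> z" by simp
qed

text \<open>For \<open>v = 0\<close> the quotient is \<open>0\<close>, so \<open>reflection 0\<close> is the identity.\<close>

definition reflection :: "'a::real_inner \<Rightarrow> 'a \<Rightarrow> 'a" where
  "reflection v y = y - (2 * (y \<bullet> v) / (v \<bullet> v)) *\<^sub>R v"

lemma orthogonal_transformation_reflection:
  fixes v :: "'a::euclidean_space"
  shows "orthogonal_transformation (reflection v)"
  unfolding orthogonal_transformation_def
proof (intro conjI allI)
  show "linear (reflection v)"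
    by (rule linearI) (simp_all add: reflection_def algebra_simps add_divide_distrib)
  fix y z show "reflection v y \<bullet> reflection v z = y \<bullet> z"
    by (cases "v = 0") (simp_all add: reflection_def inner_diff_left inner_diff_right
        inner_commute[of v z])
qed

lemma reflection_minus: "reflection (- v) = reflection v"
  by (simp add: reflection_def fun_eq_iff)

lemma reflection_orthogonal: "y \<bullet> v = 0 \<Longrightarrow> reflection v y = y"
  by (simp add: reflection_def)

text \<open>For vectors of equal length, the hyperplane orthogonal to \<open>x - y\<close> is the
  mirror between them. This supplies orthogonal maps that exchange two unit vectors and fix
  everything orthogonal to their difference.\<close>

lemma reflection_swap:
  assumes "x \<bullet> x = y \<bullet> y"
  shows "reflection (x - y) x = y"
proof (cases "x = y")
  case False
  have "2 * (x \<bullet> (x - y)) = (x - y) \<bullet> (x - y)"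
    using assms by (simp add: inner_diff_left inner_diff_right inner_commute)
  moreover have "(x - y) \<bullet> (x - y) \<noteq> 0" using False by simp
  ultimately show ?thesis by (simp add: reflection_def)
qed (simp add: reflection_def)

section \<open>Characteristic polynomials and the sorted eigenvalue vector\<close>

lemma poly_charpoly: "poly (charpoly X) r = det (mat r - X)"
proof -
  have "poly (charpoly X) r = (\<Sum>p | p permutes UNIV. of_int (sign p) *
     (\<Prod>i\<in>UNIV. poly ((mat [:0, 1:] - (\<chi> i j. [:X $ i $ j:])) $ i $ p i) r))"
    by (simp add: charpoly_def det_def poly_sum poly_prod)
  also have "\<dots> = det (mat r - X)"
    by (auto simp: det_def mat_def intro!: sum.cong prod.cong)
  finally show ?thesis .
qed

lemma charpoly_conj:
  assumes "orthogonal_matrix Q"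
  shows "charpoly (transpose Q ** X ** Q) = charpoly X"
proof -
  have "det (mat r - transpose Q ** X ** Q) = det (mat r - X)" for r
  proof -
    have QQ: "transpose Q ** Q = mat 1" using assms by (simp add: orthogonal_matrix_def)
    have mr: "transpose Q ** mat r ** Q = mat r"
    proof -
      have "mat r ** Q = Q ** mat r"
        by (simp add: vec_eq_iff matrix_matrix_mult_def mat_def if_distrib if_distribR mult_ac cong: if_cong)
      then show ?thesis
        by (metis QQ matrix_mul_assoc matrix_mul_lid)
    qed
    have "mat r - transpose Q ** X ** Q = transpose Q ** (mat r - X) ** Q"
      by (simp add: matrix_diff_ldistrib matrix_diff_rdistrib mr)
    moreover have "det (transpose Q) * det Q = 1"
      by (metis QQ det_I det_mul)
    ultimately show ?thesis by (simp add: det_mul)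
  qed
  then have "poly (charpoly (transpose Q ** X ** Q)) = poly (charpoly X)"
    by (auto simp: poly_charpoly)
  then show ?thesis by (simp add: poly_eq_poly_eq_iff)
qed

definition diag_matrix :: "real ^ 'n \<Rightarrow> real ^ 'n ^ 'n" where
  "diag_matrix d = (\<chi> i j. if i = j then d $ i else 0)"

lemma proots_charpoly_diag_matrix:
  "proots (charpoly (diag_matrix d)) = image_mset (($) d) (mset_set UNIV)"
proof -
  have "poly (charpoly (diag_matrix d)) r = poly (\<Prod>i\<in>UNIV. [:- d $ i, 1:]) r" for r
    unfolding poly_charpoly
    by (subst det_diagonal) (simp_all add: diag_matrix_def mat_def poly_prod)
  then have "charpoly (diag_matrix d) = (\<Prod>i\<in>UNIV. [:- d $ i, 1:])"
    by (metis poly_eq_poly_eq_iff ext)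
  then have "proots (charpoly (diag_matrix d)) = (\<Sum>i\<in>UNIV. {#d $ i#})"
    by (simp add: proots_prod)
  also have "\<dots> = image_mset (($) d) (mset_set UNIV)"
    by (simp add: sum_unfold_sum_mset)
  finally show ?thesis .
qed

text \<open>The rank that \<open>eigvals\<close> uses as a list position takes each value below the
  dimension once, so every root is read off exactly once.\<close>

lemma bij_betw_card_less:
  "bij_betw (\<lambda>i::'n::{finite,linorder}. card {j. j < i}) UNIV {..<CARD('n)}"
proof -
  have sm: "card {j. j < i} < card {j. j < k}" if "i < k" for i k :: 'n
    by (rule psubset_card_mono) (use that in auto)
  have inj: "inj (\<lambda>i::'n. card {j. j < i})"
    by (rule injI) (metis sm less_irrefl neqE)
  have "card {j. j < i} < CARD('n)" for i :: 'n
    by (rule psubset_card_mono) auto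
  then have "range (\<lambda>i::'n. card {j. j < i}) = {..<CARD('n)}"
    by (intro card_subset_eq) (auto simp: card_image[OF inj])
  with inj show ?thesis by (simp add: bij_betw_def)
qed

text \<open>The hypothesis says that the characteristic polynomial splits over the reals. The sorted
  list then has one entry per index, so \<open>!\<close> never leaves it.\<close>

lemma image_mset_eigvals:
  fixes X :: "real ^ 'n::{finite,linorder} ^ 'n::{finite,linorder}"
  assumes "size (proots (charpoly X)) = CARD('n)"
  shows "image_mset (($) (eigvals X)) (mset_set UNIV) = proots (charpoly X)"
proof -
  define xs where "xs = rev (sorted_list_of_multiset (proots (charpoly X)))"
  have mx: "mset xs = proots (charpoly X)" by (simp add: xs_def)
  then have len: "length xs = CARD('n)" using assms by (metis size_mset)
  have "image_mset (($) (eigvals X)) (mset_set UNIV) =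
        image_mset ((!) xs) (image_mset (\<lambda>i::'n. card {j. j < i}) (mset_set UNIV))"
    by (auto simp: eigvals_def xs_def multiset.map_comp intro!: image_mset_cong)
  also have "image_mset (\<lambda>i::'n. card {j. j < i}) (mset_set UNIV) = mset_set {..<CARD('n)}"
    using bij_betw_card_less[where 'n='n] by (metis bij_betw_def image_mset_mset_set)
  also have "image_mset ((!) xs) \<dots> = mset xs"
    by (metis len mset_map map_nth mset_upt atLeast0LessThan)
  finally show ?thesis by (simp add: mx)
qed

text \<open>Families with the same multiset of values differ by a permutation of the indices, which
  a symmetric \<open>f\<close> does not see.\<close>

lemma eigvals_of_diag:
  fixes X :: "real ^ 'n::{finite,linorder} ^ 'n::{finite,linorder}"
  assumes "charpoly X = charpoly (diag_matrix d)"
  obtains \<sigma> where "\<sigma> permutes UNIV" "eigvals X = (\<chi> i. d $ \<sigma> i)"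
proof -
  have p: "proots (charpoly X) = image_mset (($) d) (mset_set UNIV)"
    by (simp add: assms proots_charpoly_diag_matrix)
  then have "image_mset (($) (eigvals X)) (mset_set UNIV) = image_mset (($) d) (mset_set UNIV)"
    by (subst image_mset_eigvals) simp_all
  then obtain \<sigma> where "\<sigma> permutes UNIV" "\<forall>i\<in>UNIV. eigvals X $ i = d $ \<sigma> i"
    using image_mset_eq_implies_permutes[of UNIV "($) (eigvals X)" "($) d"] by auto
  then show thesis by (intro that) (auto simp: vec_eq_iff)
qed

text \<open>No index lies below \<open>Min UNIV\<close>, so it reads position 0 of the nonincreasing
  list, the largest root. Only here does the order of \<open>eigvals\<close> enter.\<close>

lemma eigvals_Min_of_diag:
  fixes X :: "real ^ 'n::{finite,linorder} ^ 'n::{finite,linorder}"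
  assumes "charpoly X = charpoly (diag_matrix d)"
  shows "eigvals X $ Min UNIV = Max (range (($) d))"
proof -
  define xs where "xs = sorted_list_of_multiset (proots (charpoly X))"
  have p: "proots (charpoly X) = image_mset (($) d) (mset_set UNIV)"
    by (simp add: assms proots_charpoly_diag_matrix)
  have xs: "set xs = range (($) d)" "sorted xs"
    using arg_cong[OF p, of set_mset] by (simp_all add: xs_def)
  then have ne: "xs \<noteq> []" by auto
  have "\<not> j < Min UNIV" for j :: 'n
    using Min_le[of UNIV j] by (simp only: finite UNIV_I not_less)
  then have 0: "card {j::'n. j < Min UNIV} = 0"
    by (simp only: Collect_empty_eq[THEN iffD2] simp_thms card.empty)
  have "eigvals X $ Min UNIV = rev xs ! 0"
    unfolding eigvals_def vec_lambda_beta xs_def 0 ..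
  also have "\<dots> = last xs" using ne by (simp add: rev_nth last_conv_nth)
  also have "\<dots> = Max (set xs)"
  proof (rule Max_eqI[symmetric])
    show "y \<le> last xs" if "y \<in> set xs" for y
      using that xs(2) ne by (auto simp: sorted_iff_nth_mono last_conv_nth in_set_conv_nth)
  qed (use ne in simp_all)
  finally show ?thesis by (simp add: xs)
qed

section \<open>Diagonalization and convexity of spectral functions\<close>

text \<open>This is the diagonal of \<open>transpose Q ** Y ** Q\<close>. The form by columns suits
  \<open>jacobi_step\<close>, where an orthogonal map acts on each column of
  \<open>Q\<close>.\<close>

definition conj_diagonal :: "real ^ 'n ^ 'n \<Rightarrow> real ^ 'n ^ 'n \<Rightarrow> real ^ 'n" where
  "conj_diagonal Y Q = (\<chi> i. column i Q \<bullet> (Y *v column i Q))"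

lemma conj_entry:
  fixes Y Q :: "real ^ 'n ^ 'n"
  shows "(transpose Q ** Y ** Q) $ i $ j = column i Q \<bullet> (Y *v column j Q)"
proof -
  have "(transpose Q ** Y ** Q) $ i $ j = axis i 1 \<bullet> ((transpose Q ** Y ** Q) *v axis j 1)"
    by (simp add: matrix_vector_mult_basis inner_axis' column_def)
  also have "\<dots> = (Q *v axis i 1) \<bullet> (Y *v (Q *v axis j 1))"
    by (metis dot_lmul_matrix inner_commute matrix_vector_mul_assoc transpose_matrix_vector transpose_transpose)
  finally show ?thesis by (simp add: matrix_vector_mult_basis)
qed

lemma sum_two_remove:
  fixes h :: "'n::finite \<Rightarrow> real"
  assumes "i \<noteq> j"
  shows "sum h UNIV = h i + (h j + sum h (UNIV - {i} - {j}))"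
  using assms by (simp add: sum.remove[of UNIV i] sum.remove[of "UNIV - {i}" j])

text \<open>A rotation in the plane of columns \<open>i\<close> and \<open>j\<close> keeps the mean
  \<open>m\<close> of the two diagonal entries and widens their gap from \<open>\<delta>\<close> to
  \<open>\<rho>\<close>. Larger squares result, while the old diagonal lies between the new one and
  its swapped copy.\<close>

lemma jacobi_step:
  fixes f :: "real ^ 'n \<Rightarrow> real"
  assumes sym: "symmetric_function f" and conv: "convex_on UNIV f"
    and Y: "transpose Y = Y" and Q: "orthogonal_matrix Q"
    and ij: "i \<noteq> j" and nz: "column i Q \<bullet> (Y *v column j Q) \<noteq> 0"
  obtains Q' where "orthogonal_matrix Q'" "f (conj_diagonal Y Q) \<le> f (conj_diagonal Y Q')"
    "(\<Sum>k\<in>UNIV. (conj_diagonal Y Q $ k)\<^sup>2) < (\<Sum>k\<in>UNIV. (conj_diagonal Y Q' $ k)\<^sup>2)"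
proof -
  define u w where "u = column i Q" and "w = column j Q"
  define p r z where "p = u \<bullet> (Y *v u)" and "r = w \<bullet> (Y *v w)" and "z = u \<bullet> (Y *v w)"
  define \<delta> where "\<delta> = p - r"
  \<comment> \<open>The gap between the eigenvalues of the 2 by 2 block with diagonal
    \<open>p\<close>, \<open>r\<close> and off-diagonal entry \<open>z\<close>.\<close>
  define \<rho> where "\<rho> = sqrt (\<delta>\<^sup>2 + 4 * z\<^sup>2)"
  have z0: "z \<noteq> 0" using nz by (simp add: z_def u_def w_def)
  have col: "column k Q \<bullet> column l Q = (if k = l then 1 else 0)" for k l
    using Q by (auto simp: orthogonal_matrix_orthonormal_columns norm_eq_1 orthogonal_def)
  have uw: "u \<bullet> u = 1" "w \<bullet> w = 1" "u \<bullet> w = 0" "w \<bullet> u = 0"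
    using ij by (simp_all add: u_def w_def col)
  have z': "w \<bullet> (Y *v u) = z" using inner_matrix_symmetric[OF Y] by (simp add: z_def)
  have \<rho>2: "\<rho>\<^sup>2 = \<delta>\<^sup>2 + 4 * z\<^sup>2" by (simp add: \<rho>_def)
  have \<rho>0: "\<rho> > 0" using z0 by (simp add: \<rho>_def add_nonneg_pos)
  have "(\<delta> / \<rho>)\<^sup>2 + (2 * z / \<rho>)\<^sup>2 = 1"
    using \<rho>0 by (simp add: power_divide add_divide_distrib[symmetric] power_mult_distrib \<rho>2[symmetric])
  then obtain \<tau> where \<tau>: "\<delta> / \<rho> = cos \<tau>" "2 * z / \<rho> = sin \<tau>"
    using sincos_total_2pi by metis
  have \<delta>\<tau>: "\<delta> = \<rho> * cos \<tau>" and z\<tau>: "2 * z = \<rho> * sin \<tau>"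
    using \<tau> \<rho>0 by (simp_all add: field_simps)
  \<comment> \<open>Rotating by this angle annihilates the \<open>(i, j)\<close> entry.\<close>
  define t where "t = \<tau> / 2"
  have c2: "(cos t)\<^sup>2 = (1 + cos \<tau>) / 2" and s2: "(sin t)\<^sup>2 = (1 - cos \<tau>) / 2"
    and sc: "2 * sin t * cos t = sin \<tau>"
  proof -
    have "\<tau> = 2 * t" by (simp add: t_def)
    then have "cos \<tau> = 2 * (cos t)\<^sup>2 - 1" "cos \<tau> = 1 - 2 * (sin t)\<^sup>2" "sin \<tau> = 2 * sin t * cos t"
      using cos_double_cos sin_double cos_double_sin by metis+
    note * = this
    show "(cos t)\<^sup>2 = (1 + cos \<tau>) / 2" using *(1) by argo
    show "(sin t)\<^sup>2 = (1 - cos \<tau>) / 2" using *(2) by argo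
    show "2 * sin t * cos t = sin \<tau>" using *(3) by argo
  qed
  define T where "T = plane_rotation u w t"
  have oT: "orthogonal_transformation T"
    unfolding T_def by (rule orthogonal_transformation_plane_rotation) (use uw in auto)
  define Q' where "Q' = matrix T ** Q"
  have oQ': "orthogonal_matrix Q'"
    unfolding Q'_def using oT Q by (simp add: orthogonal_matrix_mul orthogonal_transformation_matrix)
  have colQ': "column k Q' = T (column k Q)" for k
    unfolding Q'_def using oT
    by (metis linear_matrix_vector_mul_eq matrix_vector_mul_assoc matrix_vector_mult_basis matrix_works
        orthogonal_transformation_linear)
  have Tu: "T u = cos t *\<^sub>R u + sin t *\<^sub>R w" and Tw: "T w = cos t *\<^sub>R w - sin t *\<^sub>R u"
    by (simp_all add: T_def plane_rotation_def uw algebra_simps)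
  define d d' where "d = conj_diagonal Y Q" and "d' = conj_diagonal Y Q'"
  define m where "m = (p + r) / 2"
  have di: "d $ i = m + \<delta> / 2" and dj: "d $ j = m - \<delta> / 2"
    by (simp_all add: d_def conj_diagonal_def u_def[symmetric] w_def[symmetric] p_def[symmetric]
        r_def[symmetric] m_def \<delta>_def field_simps)
  \<comment> \<open>The vector \<open>(\<delta> / 2, z)\<close> has length \<open>\<rho> / 2\<close>
    and direction \<open>\<tau>\<close>; the left side is its component along its own
    direction.\<close>
  have rot: "cos \<tau> * (\<delta> / 2) + sin \<tau> * z = \<rho> / 2"
  proof -
    have z_eq: "z = \<rho> * sin \<tau> / 2" using z\<tau> by simp
    have "cos \<tau> * (\<delta> / 2) + sin \<tau> * z = \<rho> / 2 * ((cos \<tau>)\<^sup>2 + (sin \<tau>)\<^sup>2)"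
      unfolding \<delta>\<tau> z_eq by (simp add: power2_eq_square algebra_simps add_divide_distrib)
        (simp flip: distrib_left)
    then show ?thesis by simp
  qed
  have "d' $ i = (cos t)\<^sup>2 * p + (2 * sin t * cos t) * z + (sin t)\<^sup>2 * r"
    by (simp add: d'_def conj_diagonal_def colQ' u_def[symmetric] Tu p_def r_def z_def z'[symmetric]
        matrix_vector_right_distrib matrix_vector_mult_scaleR inner_add_left inner_add_right)
      (simp add: z' z_def[symmetric] power2_eq_square algebra_simps)
  also have "\<dots> = m + (cos \<tau> * (\<delta> / 2) + sin \<tau> * z)"
    unfolding c2 s2 sc by (simp add: m_def \<delta>_def field_simps)
  finally have d'i: "d' $ i = m + \<rho> / 2" using rot by simp
  have "d' $ j = (cos t)\<^sup>2 * r - (2 * sin t * cos t) * z + (sin t)\<^sup>2 * p"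
    by (simp add: d'_def conj_diagonal_def colQ' w_def[symmetric] Tw p_def r_def z_def z'[symmetric]
        matrix_vector_mult_diff_distrib matrix_vector_mult_scaleR inner_diff_left inner_diff_right)
      (simp add: z' z_def[symmetric] power2_eq_square algebra_simps)
  also have "\<dots> = m - (cos \<tau> * (\<delta> / 2) + sin \<tau> * z)"
    unfolding c2 s2 sc by (simp add: m_def \<delta>_def field_simps)
  finally have d'j: "d' $ j = m - \<rho> / 2" using rot by simp
  have d'k: "d' $ k = d $ k" if "k \<noteq> i" "k \<noteq> j" for k
  proof -
    have "column k Q \<bullet> u = 0" "column k Q \<bullet> w = 0" using that by (simp_all add: u_def w_def col)
    then have "T (column k Q) = column k Q" by (simp add: T_def plane_rotation_def)
    then show ?thesis by (simp add: d_def d'_def conj_diagonal_def colQ')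
  qed
  \<comment> \<open>Only entries \<open>i\<close> and \<open>j\<close> change and \<open>m\<close>
    cancels, so the sum of squares grows by \<open>2 * z^2\<close>.\<close>
  have "(\<Sum>k\<in>UNIV - {i} - {j}. (d' $ k)\<^sup>2) = (\<Sum>k\<in>UNIV - {i} - {j}. (d $ k)\<^sup>2)"
    by (rule sum.cong) (auto simp: d'k)
  then have "(\<Sum>k\<in>UNIV. (d' $ k)\<^sup>2) - (\<Sum>k\<in>UNIV. (d $ k)\<^sup>2) = (\<rho>\<^sup>2 - \<delta>\<^sup>2) / 2"
    by (simp add: sum_two_remove[OF ij] di dj d'i d'j power2_eq_square algebra_simps)
  also have "\<dots> > 0" using z0 by (simp add: \<rho>2)
  finally have less: "(\<Sum>k\<in>UNIV. (d $ k)\<^sup>2) < (\<Sum>k\<in>UNIV. (d' $ k)\<^sup>2)" by simp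
  \<comment> \<open>Since \<open>\<delta> = (2 * \<alpha> - 1) * \<rho>\<close>, this weight
    recovers \<open>m \<plusminus> \<delta> / 2\<close> from
    \<open>m \<plusminus> \<rho> / 2\<close> and its swap.\<close>
  define \<alpha> where "\<alpha> = (cos t)\<^sup>2"
  have \<alpha>: "0 \<le> \<alpha>" "\<alpha> \<le> 1" by (simp_all add: \<alpha>_def abs_square_le_1)
  define d'' where "d'' = (\<chi> k. d' $ Transposition.transpose i j k)"
  have fd'': "f d'' = f d'"
    using sym unfolding symmetric_function_def d''_def by (simp add: permutes_swap_id)
  have "d $ k = (\<alpha> *\<^sub>R d' + (1 - \<alpha>) *\<^sub>R d'') $ k" for k
  proof (cases "k = i \<or> k = j")
    case True
    have "\<delta> = (2 * \<alpha> - 1) * \<rho>" by (simp add: \<delta>\<tau> \<alpha>_def c2 field_simps)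
    then show ?thesis using True ij
      by (auto simp: d''_def d'i d'j di dj algebra_simps add_divide_distrib[symmetric] diff_divide_distrib)
  qed (simp add: d''_def d'k transpose_def algebra_simps)
  then have "d = \<alpha> *\<^sub>R d' + (1 - \<alpha>) *\<^sub>R d''" by (simp add: vec_eq_iff)
  then have "f d \<le> \<alpha> * f d' + (1 - \<alpha>) * f d''"
    using convex_onD[OF conv, of "1 - \<alpha>" d' d''] \<alpha> by simp
  then have "f d \<le> f d'" by (simp add: fd'' algebra_simps)
  with oQ' less show thesis by (intro that[of Q']) (simp_all add: d_def d'_def)
qed

text \<open>Unit rows give boundedness, and the defining polynomial equations give
  closedness.\<close>

lemma compact_orthogonal_matrices: "compact {Q :: real ^ 'n ^ 'n. orthogonal_matrix Q}"
proof -
  have "norm Q \<le> CARD('n)" if "orthogonal_matrix Q" for Q :: "real ^ 'n ^ 'n"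
  proof -
    have "norm (Q $ i) = 1" for i
      using that by (simp add: orthogonal_matrix_orthonormal_rows row_def)
    then have "norm Q = L2_set (\<lambda>i. 1) (UNIV :: 'n set)" by (simp add: norm_vec_def)
    also have "\<dots> \<le> CARD('n)" using L2_set_le_sum[of UNIV "\<lambda>i::'n. 1"] by simp
    finally show ?thesis .
  qed
  then have "bounded {Q :: real ^ 'n ^ 'n. orthogonal_matrix Q}" by (auto simp: bounded_iff)
  moreover have "{Q :: real ^ 'n ^ 'n. orthogonal_matrix Q} =
      {Q. \<forall>i j. (\<Sum>k\<in>UNIV. Q $ k $ i * Q $ k $ j) = mat 1 $ i $ j}"
    by (simp add: orthogonal_matrix vec_eq_iff matrix_matrix_mult_def transpose_def)
  moreover have "closed \<dots>"
    by (intro closed_Collect_all closed_Collect_eq continuous_intros)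
  ultimately show ?thesis by (simp add: compact_eq_bounded_closed)
qed

text \<open>A Jacobi step preserves the constraint on \<open>f\<close> and strictly raises the
  objective, so no off-diagonal entry survives at a maximizer. For constant \<open>f\<close> this is
  the spectral theorem.\<close>

lemma diagonalization:
  fixes f :: "real ^ 'n \<Rightarrow> real"
  assumes sym: "symmetric_function f" and conv: "convex_on UNIV f" and Y: "transpose Y = Y"
  obtains Q where "orthogonal_matrix Q" "transpose Q ** Y ** Q = diag_matrix (conj_diagonal Y Q)"
    "f (\<chi> i. Y $ i $ i) \<le> f (conj_diagonal Y Q)"
proof -
  have contf: "continuous_on UNIV f" by (rule convex_on_continuous[OF open_UNIV conv])
  define S where "S = {Q. orthogonal_matrix Q} \<inter> {Q. f (\<chi> i. Y $ i $ i) \<le> f (conj_diagonal Y Q)}"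
  have contd: "continuous_on UNIV (conj_diagonal Y)"
    unfolding conj_diagonal_def inner_vec_def column_def matrix_vector_mult_def
    by (intro continuous_intros)
  have "closed {Q. f (\<chi> i. Y $ i $ i) \<le> f (conj_diagonal Y Q)}"
    by (intro closed_Collect_le continuous_intros continuous_on_compose2[OF contf contd]) auto
  then have comp: "compact S"
    unfolding S_def by (intro compact_Int_closed compact_orthogonal_matrices)
  have "conj_diagonal Y (mat 1) = (\<chi> i. Y $ i $ i)"
    using conj_entry[of "mat 1" Y] by (simp add: conj_diagonal_def)
  \<comment> \<open>The identity meets the constraint with equality.\<close>
  then have "mat 1 \<in> S" by (simp add: S_def orthogonal_matrix_id)
  then have ne: "S \<noteq> {}" by blast
  have "continuous_on S (\<lambda>Q. \<Sum>k\<in>UNIV. (conj_diagonal Y Q $ k)\<^sup>2)"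
    by (intro continuous_intros continuous_on_subset[OF contd]) auto
  then obtain Q where QS: "Q \<in> S"
    and max: "\<And>Q'. Q' \<in> S \<Longrightarrow> (\<Sum>k\<in>UNIV. (conj_diagonal Y Q' $ k)\<^sup>2) \<le> (\<Sum>k\<in>UNIV. (conj_diagonal Y Q $ k)\<^sup>2)"
    using continuous_attains_sup[OF comp ne] by blast
  have Q: "orthogonal_matrix Q" "f (\<chi> i. Y $ i $ i) \<le> f (conj_diagonal Y Q)"
    using QS by (simp_all add: S_def)
  have "column i Q \<bullet> (Y *v column j Q) = 0" if ij: "i \<noteq> j" for i j
  proof (rule ccontr)
    assume "column i Q \<bullet> (Y *v column j Q) \<noteq> 0"
    from jacobi_step[OF sym conv Y Q(1) ij this] obtain Q' where Q': "orthogonal_matrix Q'"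
      "f (conj_diagonal Y Q) \<le> f (conj_diagonal Y Q')"
      "(\<Sum>k\<in>UNIV. (conj_diagonal Y Q $ k)\<^sup>2) < (\<Sum>k\<in>UNIV. (conj_diagonal Y Q' $ k)\<^sup>2)" .
    then have "Q' \<in> S" using Q(2) by (auto simp: S_def)
    from max[OF this] Q'(3) show False by simp
  qed
  then have "transpose Q ** Y ** Q = diag_matrix (conj_diagonal Y Q)"
    by (auto simp: vec_eq_iff conj_entry diag_matrix_def conj_diagonal_def)
  with Q show thesis by (intro that)
qed

lemma spectral_function_conj:
  assumes "orthogonal_matrix Q"
  shows "spectral_function f (transpose Q ** X ** Q) = spectral_function f X"
  by (simp add: spectral_function_def eigvals_def charpoly_conj[OF assms])

lemma spectral_function_diagonal:
  assumes "symmetric_function f" and "charpoly X = charpoly (diag_matrix d)"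
  shows "spectral_function f X = f d"
  using assms(1) eigvals_of_diag[OF assms(2)]
  by (metis spectral_function_def symmetric_function_def)

text \<open>For symmetric convex \<open>f\<close> this is the consequence of Schur's theorem that
  the spectrum majorizes the diagonal; here the diagonalization carries the inequality
  along.\<close>

lemma spectral_function_ge_diagonal:
  fixes f :: "real ^ 'n::{finite,linorder} \<Rightarrow> real"
  assumes "symmetric_function f" "convex_on UNIV f" "transpose Y = Y"
  shows "f (\<chi> i. Y $ i $ i) \<le> spectral_function f Y"
proof -
  obtain Q where Q: "orthogonal_matrix Q" "transpose Q ** Y ** Q = diag_matrix (conj_diagonal Y Q)"
    "f (\<chi> i. Y $ i $ i) \<le> f (conj_diagonal Y Q)"
    using diagonalization[OF assms] .
  have "spectral_function f Y = f (conj_diagonal Y Q)"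
    by (rule spectral_function_diagonal[OF assms(1)]) (metis Q(1,2) charpoly_conj)
  with Q(3) show ?thesis by simp
qed

text \<open>In a basis diagonalizing the combination \<open>C\<close>, its spectral value is
  \<open>f\<close> of a diagonal. Diagonals depend linearly on the matrix, and those of the
  conjugated \<open>A\<close> and \<open>B\<close> are bounded by
  \<open>spectral_function_ge_diagonal\<close>.\<close>

lemma spectral_function_convex:
  fixes f :: "real ^ 'n::{finite,linorder} \<Rightarrow> real"
  assumes f: "symmetric_function f" "convex_on UNIV f"
    and "transpose A = A" "transpose B = B" and t: "0 \<le> t" "t \<le> 1"
  shows "spectral_function f ((1 - t) *\<^sub>R A + t *\<^sub>R B)
    \<le> (1 - t) * spectral_function f A + t * spectral_function f B"
proof -
  define C where "C = (1 - t) *\<^sub>R A + t *\<^sub>R B"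
  have symC: "transpose C = C"
    using assms(3,4) by (simp add: C_def transpose_def vec_eq_iff)
  obtain Q where Q: "orthogonal_matrix Q" "transpose Q ** C ** Q = diag_matrix (conj_diagonal C Q)"
    using diagonalization[OF f symC] by metis
  have le: "f (conj_diagonal Y Q) \<le> spectral_function f Y" if "transpose Y = Y" for Y
  proof -
    have "transpose (transpose Q ** Y ** Q) = transpose Q ** Y ** Q"
      by (simp add: matrix_transpose_mul that matrix_mul_assoc)
    from spectral_function_ge_diagonal[OF f this] show ?thesis
      by (simp add: spectral_function_conj[OF Q(1)] conj_entry conj_diagonal_def)
  qed
  have "spectral_function f C = f (conj_diagonal C Q)"
    by (rule spectral_function_diagonal[OF f(1)]) (metis Q charpoly_conj)
  also have "conj_diagonal C Q = (1 - t) *\<^sub>R conj_diagonal A Q + t *\<^sub>R conj_diagonal B Q"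
    by (simp add: C_def conj_diagonal_def vec_eq_iff matrix_vector_mult_add_rdistrib
        scaleR_matrix_vector_assoc[symmetric] inner_add_right)
  also have "f \<dots> \<le> (1 - t) * f (conj_diagonal A Q) + t * f (conj_diagonal B Q)"
    using convex_onD[OF f(2)] t by simp
  also have "\<dots> \<le> (1 - t) * spectral_function f A + t * spectral_function f B"
    using le[OF assms(3)] le[OF assms(4)] t by (intro add_mono mult_left_mono) auto
  finally show ?thesis by (simp add: C_def)
qed

section \<open>Subgradients at differences of rank-one matrices\<close>

text \<open>Conjugation by \<open>T\<close> keeps the spectral value, so the linear term of the
  subgradient inequality cannot be positive. On rank-one matrices that term is a difference of
  quadratic forms.\<close>

lemma spectral_subgradient_rotation:
  fixes x b :: "real ^ 'n::{finite,linorder}"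
  assumes V: "V \<in> sym_subdifferential (spectral_function f) (outer_product x x - outer_product b b)"
    and T: "orthogonal_transformation T"
  shows "T x \<bullet> (V *v T x) - T b \<bullet> (V *v T b) \<le> x \<bullet> (V *v x) - b \<bullet> (V *v b)"
proof -
  define Q where "Q = matrix T"
  have Q: "orthogonal_matrix (transpose Q)" "\<And>y. Q *v y = T y"
    using T by (simp_all add: Q_def orthogonal_transformation_matrix matrix_works linear_matrix_vector_mul_eq)
  have "outer_product (T x) (T x) - outer_product (T b) (T b)
      = transpose (transpose Q) ** (outer_product x x - outer_product b b) ** transpose Q"
    by (simp add: matrix_diff_ldistrib matrix_diff_rdistrib conj_outer_product Q(2))
  then have "spectral_function f (outer_product (T x) (T x) - outer_product (T b) (T b))
      = spectral_function f (outer_product x x - outer_product b b)"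
    by (simp only: spectral_function_conj[OF Q(1)])
  moreover have "transpose (outer_product (T x) (T x) - outer_product (T b) (T b))
      = outer_product (T x) (T x) - outer_product (T b) (T b)"
    by (simp add: transpose_def outer_product_def vec_eq_iff mult.commute)
  ultimately have "trace (V ** ((outer_product (T x) (T x) - outer_product (T b) (T b))
      - (outer_product x x - outer_product b b))) \<le> 0"
    using V unfolding sym_subdifferential_def by fastforce
  then show ?thesis
    by (simp add: matrix_diff_ldistrib trace_sub trace_mult_outer_product)
qed

text \<open>At angle 0 the point \<open>y\<close> moves with velocity \<open>a\<close>, while
  \<open>cos t - 1\<close> vanishes to second order.\<close>

lemma plane_rotation_quadratic_deriv:
  fixes V :: "real ^ 'n ^ 'n"
  assumes V: "transpose V = V"
  shows "((\<lambda>t. plane_rotation u w t y \<bullet> (V *v plane_rotation u w t y)) has_real_derivative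
    2 * (y \<bullet> (V *v ((y \<bullet> u) *\<^sub>R w - (y \<bullet> w) *\<^sub>R u)))) (at 0)"
proof -
  define p where "p = (y \<bullet> u) *\<^sub>R u + (y \<bullet> w) *\<^sub>R w"
  define a where "a = (y \<bullet> u) *\<^sub>R w - (y \<bullet> w) *\<^sub>R u"
  have "plane_rotation u w t y \<bullet> (V *v plane_rotation u w t y) =
      y \<bullet> (V *v y) + 2 * (cos t - 1) * (y \<bullet> (V *v p)) + 2 * sin t * (y \<bullet> (V *v a))
      + (cos t - 1)\<^sup>2 * (p \<bullet> (V *v p)) + 2 * (cos t - 1) * sin t * (p \<bullet> (V *v a))
      + (sin t)\<^sup>2 * (a \<bullet> (V *v a))" for t
  proof -
    have "(y + C *\<^sub>R p + S *\<^sub>R a) \<bullet> (V *v (y + C *\<^sub>R p + S *\<^sub>R a)) =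
      y \<bullet> (V *v y) + 2 * C * (y \<bullet> (V *v p)) + 2 * S * (y \<bullet> (V *v a))
      + C\<^sup>2 * (p \<bullet> (V *v p)) + 2 * C * S * (p \<bullet> (V *v a)) + S\<^sup>2 * (a \<bullet> (V *v a))" for C S
      using inner_matrix_symmetric[OF V, of p y] inner_matrix_symmetric[OF V, of a y]
        inner_matrix_symmetric[OF V, of a p]
      by (simp add: matrix_vector_right_distrib matrix_vector_mult_scaleR inner_add_left inner_add_right
          power2_eq_square algebra_simps)
    then show ?thesis by (simp add: plane_rotation_def p_def[symmetric] a_def[symmetric])
  qed
  then show ?thesis
    unfolding a_def[symmetric]
    by (auto intro!: derivative_eq_intros)
qed

text \<open>The identity is a maximum along every one-parameter rotation group, so the derivative
  vanishes there. All these equations together say that \<open>V\<close> commutes with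
  \<open>outer_product x x - outer_product b b\<close>.\<close>

lemma spectral_subgradient_first_order:
  fixes x b u w :: "real ^ 'n::{finite,linorder}"
  assumes V: "V \<in> sym_subdifferential (spectral_function f) (outer_product x x - outer_product b b)"
    and uw: "u \<bullet> u = 1" "w \<bullet> w = 1" "u \<bullet> w = 0"
  shows "x \<bullet> (V *v ((x \<bullet> u) *\<^sub>R w - (x \<bullet> w) *\<^sub>R u)) = b \<bullet> (V *v ((b \<bullet> u) *\<^sub>R w - (b \<bullet> w) *\<^sub>R u))"
proof -
  have symV: "transpose V = V" using V by (simp add: sym_subdifferential_def)
  define \<phi> where "\<phi> t = plane_rotation u w t x \<bullet> (V *v plane_rotation u w t x)
      - plane_rotation u w t b \<bullet> (V *v plane_rotation u w t b)" for t
  have deriv: "(\<phi> has_real_derivative 2 * (x \<bullet> (V *v ((x \<bullet> u) *\<^sub>R w - (x \<bullet> w) *\<^sub>R u)))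
      - 2 * (b \<bullet> (V *v ((b \<bullet> u) *\<^sub>R w - (b \<bullet> w) *\<^sub>R u)))) (at 0)"
    unfolding \<phi>_def by (intro DERIV_diff plane_rotation_quadratic_deriv[OF symV])
  have max: "\<phi> t \<le> \<phi> 0" for t
    using spectral_subgradient_rotation[OF V orthogonal_transformation_plane_rotation[OF uw]]
    by (simp add: \<phi>_def plane_rotation_def[of _ _ 0])
  have "2 * (x \<bullet> (V *v ((x \<bullet> u) *\<^sub>R w - (x \<bullet> w) *\<^sub>R u)))
      - 2 * (b \<bullet> (V *v ((b \<bullet> u) *\<^sub>R w - (b \<bullet> w) *\<^sub>R u))) = 0"
    using DERIV_local_max[OF deriv, of 1] max by auto
  then show ?thesis by simp
qed

lemma orthonormal_rescale:
  fixes w :: "'a::real_inner"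
  assumes "w \<noteq> 0"
  shows "sgn w \<bullet> sgn w = 1" "w = norm w *\<^sub>R sgn w"
  using assms by (simp_all add: sgn_div_norm power2_norm_eq_inner[symmetric] power2_eq_square)

text \<open>With \<open>V *v x = 0\<close> one side of the first order equation vanishes. In the
  plane of \<open>b\<close> and any \<open>w\<close> orthogonal to it, the other side forces
  \<open>V *v b\<close> to be orthogonal to \<open>w\<close>.\<close>

lemma spectral_subgradient_eigenvector:
  fixes x b :: "real ^ 'n::{finite,linorder}"
  assumes V: "V \<in> sym_subdifferential (spectral_function f) (outer_product x x - outer_product b b)"
    and Vx: "V *v x = 0" and b: "b \<noteq> 0"
  obtains \<mu> where "V *v b = \<mu> *\<^sub>R b"
proof -
  have symV: "transpose V = V" using V by (simp add: sym_subdifferential_def)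
  have orth: "w \<bullet> (V *v b) = 0" if w: "b \<bullet> w = 0" "w \<noteq> 0" for w
  proof -
    have bw: "sgn b \<bullet> sgn w = 0" "b \<bullet> sgn w = 0" using w by (simp_all add: sgn_div_norm)
    have bb: "b \<bullet> sgn b \<noteq> 0" using b by (simp add: sgn_div_norm)
    have "x \<bullet> (V *v z) = 0" for z
      using inner_matrix_symmetric[OF symV, of x z] Vx by simp
    then have "(b \<bullet> sgn b) * (b \<bullet> (V *v sgn w)) = 0"
      using spectral_subgradient_first_order[OF V orthonormal_rescale(1)[OF b]
          orthonormal_rescale(1)[OF w(2)] bw(1)] bw(2)
      by (simp add: matrix_vector_mult_scaleR)
    then have "sgn w \<bullet> (V *v b) = 0" using bb inner_matrix_symmetric[OF symV, of b "sgn w"] by simp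
    then show ?thesis using w(2) by (simp add: sgn_div_norm)
  qed
  \<comment> \<open>The Rayleigh quotient is the value that makes the residual \<open>e\<close>
    orthogonal to \<open>b\<close>.\<close>
  define \<mu> where "\<mu> = (b \<bullet> (V *v b)) / (b \<bullet> b)"
  define e where "e = V *v b - \<mu> *\<^sub>R b"
  have be: "b \<bullet> e = 0" using b by (simp add: e_def \<mu>_def inner_diff_right)
  have "e = 0"
  proof (rule ccontr)
    assume "e \<noteq> 0"
    then have "e \<bullet> (V *v b) = 0" using orth be by blast
    then have "e \<bullet> e = 0" using be by (simp add: e_def[THEN arg_cong, of "\<lambda>z. e \<bullet> z"] inner_diff_right inner_commute)
    with \<open>e \<noteq> 0\<close> show False by simp
  qed
  then show thesis by (intro that[of \<mu>]) (simp add: e_def)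
qed

text \<open>Reflections compare the direction \<open>p\<close> of \<open>x\<close> with the
  direction \<open>r\<close> of \<open>b\<close> and with everything orthogonal to \<open>r\<close>;
  the first order condition removes the mixed terms. Both directions of the theorem rest on this,
  once with \<open>V *v x = 0\<close> known and once to derive it.\<close>

lemma spectral_subgradient_Rayleigh_max:
  fixes x b z :: "real ^ 'n::{finite,linorder}"
  assumes V: "V \<in> sym_subdifferential (spectral_function f) (outer_product x x - outer_product b b)"
    and xb: "x \<bullet> b = 0" and x: "x \<noteq> 0" and b: "b \<noteq> 0"
  shows "(z \<bullet> (V *v z)) * (x \<bullet> x) \<le> (x \<bullet> (V *v x)) * (z \<bullet> z)"
proof -
  have symV: "transpose V = V" using V by (simp add: sym_subdifferential_def)
  define q where "q y = y \<bullet> (V *v y)" for y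
  have q_scale: "q (c *\<^sub>R y) = c\<^sup>2 * q y" for c y
    by (simp add: q_def matrix_vector_mult_scaleR power2_eq_square)
  define p r where "p = sgn x" and "r = sgn b"
  have p: "p \<bullet> p = 1" "x = norm x *\<^sub>R p" and r: "r \<bullet> r = 1" "b = norm b *\<^sub>R r"
    using orthonormal_rescale[OF x] orthonormal_rescale[OF b] by (simp_all only: p_def r_def)
  have pr: "p \<bullet> r = 0" using xb by (simp add: p_def r_def sgn_div_norm)
  have nx: "norm x > 0" and nb: "norm b > 0" using x b by simp_all
  have Vn: "q (T x) - q (T b) \<le> (norm x)\<^sup>2 * q p - (norm b)\<^sup>2 * q r"
    if "orthogonal_transformation T" for T
  proof -
    have "q x = (norm x)\<^sup>2 * q p" "q b = (norm b)\<^sup>2 * q r"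
      using p(2) r(2) q_scale by metis+
    then show ?thesis using spectral_subgradient_rotation[OF V that] by (simp add: q_def)
  qed
  have Tx: "T x = norm x *\<^sub>R T p" "T b = norm b *\<^sub>R T r" if "orthogonal_transformation T" for T
    using that p(2) r(2) by (metis linear_scale orthogonal_transformation_linear)+
  have Vn': "(norm x)\<^sup>2 * q (T p) - (norm b)\<^sup>2 * q (T r) \<le> (norm x)\<^sup>2 * q p - (norm b)\<^sup>2 * q r"
    if "orthogonal_transformation T" for T
    using Vn[OF that] Tx[OF that] q_scale by simp
  have rp: "q r \<le> q p"
  proof -
    \<comment> \<open>Exchanging \<open>p\<close> and \<open>r\<close> yields the claim multiplied
      by the sum of the two squared norms.\<close>
    have swap: "reflection (p - r) p = r" using p(1) r(1) by (intro reflection_swap) simp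
    moreover have "reflection (r - p) r = p" using p(1) r(1) by (intro reflection_swap) simp
    moreover have "reflection (r - p) = reflection (p - r)"
      by (metis reflection_minus minus_diff_eq)
    ultimately have "(norm x)\<^sup>2 * q r - (norm b)\<^sup>2 * q p \<le> (norm x)\<^sup>2 * q p - (norm b)\<^sup>2 * q r"
      using Vn'[OF orthogonal_transformation_reflection, of "p - r"] by simp
    then have "((norm x)\<^sup>2 + (norm b)\<^sup>2) * q r \<le> ((norm x)\<^sup>2 + (norm b)\<^sup>2) * q p"
      by (simp add: algebra_simps)
    moreover have "(norm x)\<^sup>2 + (norm b)\<^sup>2 > 0" using nx by (simp add: add_pos_nonneg)
    ultimately show ?thesis by (simp add: mult_le_cancel_left_pos)
  qed
  have wp: "q w \<le> (w \<bullet> w) * q p" if wr: "w \<bullet> r = 0" for w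
  proof (cases "w = 0")
    case True
    then show ?thesis by (simp add: q_def)
  next
    case False
    note w = orthonormal_rescale[OF False]
    \<comment> \<open>This reflection moves \<open>p\<close> to the direction of \<open>w\<close>
      but fixes \<open>r\<close>, so the terms in \<open>r\<close> cancel.\<close>
    have "reflection (p - sgn w) p = sgn w" using p(1) w(1) by (intro reflection_swap) simp
    moreover have "r \<bullet> (p - sgn w) = 0"
      using pr wr by (simp add: inner_diff_right inner_commute sgn_div_norm)
    then have "reflection (p - sgn w) r = r" by (rule reflection_orthogonal)
    ultimately have "(norm x)\<^sup>2 * q (sgn w) \<le> (norm x)\<^sup>2 * q p"
      using Vn'[OF orthogonal_transformation_reflection, of "p - sgn w"] by simp
    then have "q (sgn w) \<le> q p" using nx by simp
    moreover have "q w = (norm w)\<^sup>2 * q (sgn w)" using w(2) q_scale by metis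
    ultimately show ?thesis by (simp add: power2_norm_eq_inner[symmetric] mult_left_mono)
  qed
  have first: "- (x \<bullet> w) * (x \<bullet> (V *v r)) = norm b * (b \<bullet> (V *v w))"
    if w: "w \<bullet> w = 1" "r \<bullet> w = 0" for w
  proof -
    have "b \<bullet> r = norm b" by (subst r(2)) (simp add: r(1))
    moreover have "b \<bullet> w = 0" by (subst r(2)) (simp add: w)
    moreover have "x \<bullet> r = 0" by (subst p(2)) (simp add: pr)
    ultimately show ?thesis
      using spectral_subgradient_first_order[OF V r(1) w]
      by (simp add: matrix_vector_mult_scaleR flip: scaleR_minus_left)
  qed
  have bV: "b \<bullet> (V *v y) = norm b * (r \<bullet> (V *v y))" and xV: "x \<bullet> (V *v y) = norm x * (p \<bullet> (V *v y))" for y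
    by (subst r(2), simp) (subst p(2), simp)
  have pVr: "p \<bullet> (V *v r) = 0"
  proof -
    have "x \<bullet> p = norm x" by (subst p(2)) (simp add: p(1))
    \<comment> \<open>The choice \<open>w = p\<close> gives opposite multiples of one mixed term, by
      symmetry of \<open>V\<close>; once it vanishes, \<open>first\<close> covers every
      \<open>w\<close> orthogonal to \<open>r\<close>.\<close>
    then have "((norm x)\<^sup>2 + (norm b)\<^sup>2) * (p \<bullet> (V *v r)) = 0"
      using first[OF p(1)] pr inner_matrix_symmetric[OF symV, of r p]
      by (simp add: bV xV inner_commute power2_eq_square algebra_simps)
    with x show ?thesis by simp
  qed
  have rVw: "r \<bullet> (V *v w) = 0" if wr: "r \<bullet> w = 0" for w
  proof (cases "w = 0")
    case False
    note w = orthonormal_rescale[OF False]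
    have "r \<bullet> sgn w = 0" using wr by (simp add: sgn_div_norm)
    from first[OF w(1) this] have "r \<bullet> (V *v sgn w) = 0"
      using nb by (simp add: bV xV pVr)
    then show ?thesis by (subst w(2)) (simp add: matrix_vector_mult_scaleR)
  qed simp
  define \<alpha> where "\<alpha> = z \<bullet> r"
  define w where "w = z - \<alpha> *\<^sub>R r"
  have wr: "w \<bullet> r = 0" by (simp add: w_def \<alpha>_def inner_diff_left r(1))
  have z: "z = \<alpha> *\<^sub>R r + w" by (simp add: w_def)
  have zz: "z \<bullet> z = \<alpha>\<^sup>2 + w \<bullet> w"
    unfolding z using wr by (simp add: inner_add_left inner_add_right inner_commute r(1) power2_eq_square)
  have "w \<bullet> (V *v r) = 0" "r \<bullet> (V *v w) = 0"
    using rVw[of w] wr inner_matrix_symmetric[OF symV, of w r] by (simp_all add: inner_commute)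
  then have "q z = \<alpha>\<^sup>2 * q r + q w"
    unfolding z q_def by (simp add: matrix_vector_right_distrib matrix_vector_mult_scaleR
        inner_add_left inner_add_right power2_eq_square)
  also have "\<dots> \<le> \<alpha>\<^sup>2 * q p + (w \<bullet> w) * q p"
    using rp wp[OF wr] by (intro add_mono mult_left_mono) auto
  finally have "q z \<le> (z \<bullet> z) * q p" by (simp add: zz algebra_simps)
  then have "q z * (norm x)\<^sup>2 \<le> (z \<bullet> z) * q p * (norm x)\<^sup>2" by (rule mult_right_mono) simp
  moreover have "q x = (norm x)\<^sup>2 * q p" using p(2) q_scale by metis
  ultimately show ?thesis by (simp add: q_def power2_norm_eq_inner mult_ac)
qed

section \<open>The largest eigenvalue and the Rayleigh quotient\<close>

lemma diag_matrix_mult_vec: "diag_matrix d *v y = (\<chi> i. d $ i * y $ i)"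
  by (simp add: vec_eq_iff diag_matrix_def matrix_vector_mult_def if_distrib if_distribR cong: if_cong)

text \<open>Diagonalization with the constant \<open>f = 0\<close> turns the form into a weighted
  sum of squares. The largest weight bounds it and is attained at a column of
  \<open>Q\<close>.\<close>

lemma eigvals_Min_Rayleigh:
  fixes V :: "real ^ 'n::{finite,linorder} ^ 'n::{finite,linorder}"
  assumes V: "transpose V = V"
  shows "z \<bullet> (V *v z) \<le> eigvals V $ Min UNIV * (z \<bullet> z)"
    and "\<exists>v. v \<bullet> v = 1 \<and> v \<bullet> (V *v v) = eigvals V $ Min UNIV"
proof -
  have "symmetric_function (\<lambda>_ :: real ^ 'n::{finite,linorder}. 0 :: real)"
    "convex_on UNIV (\<lambda>_ :: real ^ 'n::{finite,linorder}. 0 :: real)"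
    by (simp_all add: symmetric_function_def convex_on_def)
  from diagonalization[OF this V] obtain Q where Q: "orthogonal_matrix Q"
    "transpose Q ** V ** Q = diag_matrix (conj_diagonal V Q)" by metis
  define d where "d = conj_diagonal V Q"
  have "charpoly V = charpoly (diag_matrix d)" using Q charpoly_conj d_def by metis
  then have top: "eigvals V $ Min UNIV = Max (range (($) d))" by (rule eigvals_Min_of_diag)
  have entry: "column i Q \<bullet> (V *v column j Q) = (if i = j then d $ i else 0)" for i j
    using arg_cong[OF Q(2), of "\<lambda>M. M $ i $ j"] by (simp add: conj_entry diag_matrix_def d_def)
  have "Max (range (($) d)) \<in> range (($) d)" by (rule Max_in) auto
  then obtain i where i: "Max (range (($) d)) = d $ i" by blast
  have "column i Q \<bullet> column i Q = 1"
    using Q(1) by (simp add: orthogonal_matrix_orthonormal_columns norm_eq_1)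
  then show "\<exists>v. v \<bullet> v = 1 \<and> v \<bullet> (V *v v) = eigvals V $ Min UNIV"
    using entry[of i i] top i by auto
  define y where "y = transpose Q *v z"
  have z: "z = Q *v y" by (simp only: y_def orthogonal_matrix_transpose_mult[OF Q(1)])
  have "z \<bullet> z = (\<Sum>i\<in>UNIV. (y $ i)\<^sup>2)"
  proof -
    have "orthogonal_transformation ((*v) (transpose Q))"
      using Q(1) by (simp add: orthogonal_transformation_matrix)
    then have "z \<bullet> z = y \<bullet> y" by (simp add: y_def orthogonal_transformation_def)
    then show ?thesis by (simp add: inner_vec_def power2_eq_square)
  qed
  moreover have "z \<bullet> (V *v z) = y \<bullet> (diag_matrix d *v y)"
    unfolding z d_def Q(2)[symmetric]
    by (metis dot_lmul_matrix inner_commute matrix_vector_mul_assoc transpose_matrix_vector transpose_transpose)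
  then have "z \<bullet> (V *v z) = (\<Sum>i\<in>UNIV. d $ i * (y $ i)\<^sup>2)"
    by (simp add: inner_vec_def diag_matrix_mult_vec power2_eq_square mult_ac)
  moreover have "d $ i \<le> Max (range (($) d))" for i by (rule Max_ge) auto
  ultimately show "z \<bullet> (V *v z) \<le> eigvals V $ Min UNIV * (z \<bullet> z)"
    unfolding top by (simp add: sum_distrib_left sum_mono mult_right_mono)
qed

text \<open>Moving from the maximizer \<open>x\<close> in the direction \<open>e = V *v x\<close>
  changes the form at the rate \<open>2 * (e \<bullet> e)\<close>, which must vanish.\<close>

lemma kernel_of_Rayleigh_max:
  fixes V :: "real ^ 'n ^ 'n"
  assumes V: "transpose V = V" and le: "\<And>z. z \<bullet> (V *v z) \<le> 0" and x: "x \<bullet> (V *v x) = 0"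
  shows "V *v x = 0"
proof -
  define e where "e = V *v x"
  define \<phi> where "\<phi> t = (x + t *\<^sub>R e) \<bullet> (V *v (x + t *\<^sub>R e))" for t
  have \<phi>: "\<phi> t = 2 * t * (e \<bullet> e) + t\<^sup>2 * (e \<bullet> (V *v e))" for t
    using inner_matrix_symmetric[OF V, of x e] x
    by (simp add: \<phi>_def matrix_vector_right_distrib matrix_vector_mult_scaleR inner_add_left
        inner_add_right power2_eq_square e_def[symmetric] algebra_simps)
  have deriv: "(\<phi> has_real_derivative 2 * (e \<bullet> e)) (at 0)"
    unfolding \<phi> by (auto intro!: derivative_eq_intros)
  have max: "\<phi> t \<le> \<phi> 0" for t
    using le by (simp add: \<phi>_def x)
  have "2 * (e \<bullet> e) = 0"
    using DERIV_local_max[OF deriv, of 1] max by auto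
  then show ?thesis by (simp add: e_def)
qed

section \<open>Subgradients and stationary points\<close>

text \<open>Strictness keeps this set disjoint from a flat space at the height of a minimum, as
  separation requires.\<close>

lemma convex_strict_epigraph:
  assumes "convex_on UNIV F"
  shows "convex {(y, s). F y < (s::real)}"
proof (rule convexI)
  fix p q u v assume p: "p \<in> {(y, s). F y < s}" and q: "q \<in> {(y, s). F y < s}"
    and uv: "0 \<le> (u::real)" "0 \<le> v" "u + v = 1"
  obtain y s z t where pq: "p = (y, s)" "q = (z, t)" by fastforce
  have "F (u *\<^sub>R y + v *\<^sub>R z) \<le> u * F y + v * F z"
    using assms uv unfolding convex_on_def by blast
  also have "\<dots> < u * s + v * t"
  proof (cases "u = 0")
    case True
    then show ?thesis using p q uv pq by simp
  next
    case False
    then have "u * F y < u * s" using p uv pq by simp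
    moreover have "v * F z \<le> v * t" using q uv pq by (simp add: mult_left_mono)
    ultimately show ?thesis by simp
  qed
  finally show "u *\<^sub>R p + v *\<^sub>R q \<in> {(y, s). F y < s}" by (simp add: pq)
qed

text \<open>A hyperplane separating the strict epigraph from the flat space \<open>C\<close> through
  \<open>(x, F x)\<close> has a normal with positive last coordinate; dividing by it gives the
  subgradient.\<close>

lemma subgradient_orthogonal_subspace:
  fixes F :: "'a::euclidean_space \<Rightarrow> real"
  assumes conv: "convex_on UNIV F" and S: "subspace S" and le: "\<And>s. s \<in> S \<Longrightarrow> F x \<le> F (x + s)"
  obtains v where "\<And>y. F x + v \<bullet> (y - x) \<le> F y" "\<And>s. s \<in> S \<Longrightarrow> v \<bullet> s = 0"
proof -
  define C where "C = (+) (x, F x) ` (S \<times> {0})"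
  have "convex C"
    by (simp add: C_def convex_translation convex_Times subspace_imp_convex[OF S])
  moreover have "C \<noteq> {}" using subspace_0[OF S] by (auto simp: C_def)
  moreover have "{(y, s). F y < s} \<noteq> {}" using less_add_one[of "F x"] by blast
  moreover have "C \<inter> {(y, s). F y < s} = {}"
    using le by (force simp: C_def not_less)
  ultimately obtain a b where a: "a \<noteq> 0" "\<forall>p\<in>C. a \<bullet> p \<le> b" "\<forall>p\<in>{(y, s). F y < s}. b \<le> a \<bullet> p"
    using separating_hyperplane_sets[OF _ convex_strict_epigraph[OF conv]] by metis
  obtain A \<alpha> where A: "a = (A, \<alpha>)" by fastforce
  have below: "A \<bullet> (x + s) + \<alpha> * F x \<le> b" if "s \<in> S" for s
    using a(2) that by (force simp: C_def A)
  have above: "b \<le> A \<bullet> y + \<alpha> * t" if "F y < t" for y t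
    using a(3) that by (force simp: A)
  have bx: "A \<bullet> x + \<alpha> * F x \<le> b" using below[OF subspace_0[OF S]] by simp
  have "0 \<le> \<alpha>" using above[of x "F x + 1"] bx by (simp add: algebra_simps)
  \<comment> \<open>A vertical hyperplane would bound \<open>A\<close> from below over the whole
    space, since \<open>F\<close> is finite everywhere.\<close>
  moreover have "\<alpha> \<noteq> 0"
  proof
    assume "\<alpha> = 0"
    then have "A \<bullet> A \<le> 0"
      using above[of "x - A" "F (x - A) + 1"] bx by (simp add: inner_diff_right)
    then have "A = 0" by (metis inner_eq_zero_iff inner_ge_zero order_antisym)
    with a(1) show False by (simp add: A \<open>\<alpha> = 0\<close> zero_prod_def)
  qed
  ultimately have \<alpha>: "\<alpha> > 0" by simp
  have above': "b \<le> A \<bullet> y + \<alpha> * F y" for y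
  proof (rule field_le_epsilon)
    fix e :: real assume "e > 0"
    then show "b \<le> A \<bullet> y + \<alpha> * F y + e"
      using above[of y "F y + e / \<alpha>"] \<alpha> by (simp add: algebra_simps)
  qed
  \<comment> \<open>The functional is nonpositive on \<open>S\<close>, hence zero, because
    \<open>S\<close> contains \<open>- s\<close> with \<open>s\<close>.\<close>
  have "A \<bullet> s = 0" if "s \<in> S" for s
  proof -
    have "A \<bullet> s \<le> 0" if "s \<in> S" for s
      using below[OF that] above'[of x] by (simp add: inner_add_right)
    from this[OF that] this[OF subspace_neg[OF S that]] show ?thesis by simp
  qed
  moreover have "F x + (- (1 / \<alpha>) *\<^sub>R A) \<bullet> (y - x) \<le> F y" for y
    using above'[of y] bx \<alpha> by (simp add: inner_diff_right field_simps)
  ultimately show thesis by (intro that[of "- (1 / \<alpha>) *\<^sub>R A"]) simp_all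
qed

text \<open>
  Composing with \<open>sym_part\<close> extends a function of symmetric matrices to the whole Euclidean space;
  every subgradient of the extension is symmetric because the extension is constant along
  antisymmetric directions.
\<close>

definition sym_part :: "real ^ 'n ^ 'n \<Rightarrow> real ^ 'n ^ 'n" where
  "sym_part Y = (1 / 2) *\<^sub>R (Y + transpose Y)"

lemma linear_sym_part: "linear sym_part"
  by (rule linearI) (simp_all add: sym_part_def transpose_def vec_eq_iff algebra_simps)

lemma transpose_sym_part [simp]: "transpose (sym_part Y) = sym_part Y"
  by (simp add: sym_part_def transpose_def vec_eq_iff algebra_simps)

lemma sym_part_symmetric: "transpose Y = Y \<Longrightarrow> sym_part Y = Y"
  by (simp add: sym_part_def flip: scaleR_2)

lemma convex_on_spectral_function_sym_part:
  fixes f :: "real ^ 'n::{finite,linorder} \<Rightarrow> real"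
  assumes "symmetric_function f" "convex_on UNIV f"
  shows "convex_on UNIV (\<lambda>Y. spectral_function f (sym_part Y))"
proof (rule convex_onI)
  fix t :: real and A B :: "real ^ 'n::{finite,linorder} ^ 'n::{finite,linorder}"
  assume "0 < t" "t < 1"
  then show "spectral_function f (sym_part ((1 - t) *\<^sub>R A + t *\<^sub>R B))
    \<le> (1 - t) * spectral_function f (sym_part A) + t * spectral_function f (sym_part B)"
    using spectral_function_convex[OF assms, of "sym_part A" "sym_part B" t]
    by (simp add: linear_add[OF linear_sym_part] linear_scale[OF linear_sym_part])
qed simp

text \<open>A finite convex function on a Euclidean space is continuous, and the extension by
  \<open>sym_part\<close> is one.\<close>

lemma tendsto_spectral_function:
  fixes f :: "real ^ 'n::{finite,linorder} \<Rightarrow> real"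
  assumes f: "symmetric_function f" "convex_on UNIV f"
    and "(Y \<longlongrightarrow> L) G" "\<And>k. transpose (Y k) = Y k" "transpose L = L"
  shows "((\<lambda>k. spectral_function f (Y k)) \<longlongrightarrow> spectral_function f L) G"
proof -
  have "isCont (\<lambda>Y. spectral_function f (sym_part Y)) L"
    using convex_on_continuous[OF open_UNIV convex_on_spectral_function_sym_part[OF f]]
    by (simp add: continuous_on_eq_continuous_at)
  from isCont_tendsto_compose[OF this assms(3)] show ?thesis
    by (simp add: sym_part_symmetric assms)
qed

lemma inner_eq_trace: "V \<bullet> Z = trace (transpose V ** Z)" for V Z :: "real ^ 'n ^ 'n"
  unfolding trace_def inner_vec_def matrix_matrix_mult_def transpose_def
  by simp (rule sum.swap)

lemma sym_subdifferential_spectral_function: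
  fixes X :: "real ^ 'n::{finite,linorder} ^ 'n::{finite,linorder}"
  assumes X: "transpose X = X"
    and V: "\<And>Y. spectral_function f (sym_part X) + V \<bullet> (Y - X) \<le> spectral_function f (sym_part Y)"
  shows "V \<in> sym_subdifferential (spectral_function f) X"
proof -
  have "sym_part (X + (V - transpose V)) = sym_part X"
    by (simp add: sym_part_def transpose_def vec_eq_iff)
  then have "V \<bullet> (V - transpose V) \<le> 0" using V[of "X + (V - transpose V)"] by simp
  moreover have "transpose V \<bullet> transpose V = V \<bullet> V"
    unfolding inner_vec_def transpose_def by simp (rule sum.swap)
  then have "(V - transpose V) \<bullet> (V - transpose V) = 2 * (V \<bullet> (V - transpose V))"
    by (simp add: inner_diff_left inner_diff_right inner_commute)
  ultimately have "(V - transpose V) \<bullet> (V - transpose V) \<le> 0" by simp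
  then have symV: "transpose V = V"
    by (metis eq_iff_diff_eq_0 inner_eq_zero_iff inner_ge_zero order_antisym)
  show ?thesis
    unfolding sym_subdifferential_def
    using V symV by (auto simp: sym_part_symmetric X inner_eq_trace) (metis sym_part_symmetric)
qed

section \<open>Stationarity in terms of kernels of subgradients\<close>

lemma transpose_diff [simp]: "transpose (A - B) = transpose A - transpose B"
  by (simp add: transpose_def vec_eq_iff)

lemma transpose_add [simp]: "transpose (A + B) = transpose A + transpose B"
  by (simp add: transpose_def vec_eq_iff)

lemma transpose_outer_product [simp]: "transpose (outer_product x y) = outer_product y x"
  by (simp add: transpose_def outer_product_def vec_eq_iff mult.commute)

text \<open>The matrices added to \<open>X\<close> are the tangent directions of the map sending
  \<open>y\<close> to \<open>outer_product y y\<close> at \<open>x\<close>. They form a subspace,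
  and a subgradient orthogonal to it satisfies \<open>h \<bullet> (V *v x) = 0\<close> for all
  \<open>h\<close>.\<close>

lemma subgradient_annihilating:
  fixes f :: "real ^ 'n::{finite,linorder} \<Rightarrow> real"
  assumes f: "symmetric_function f" "convex_on UNIV f" and X: "transpose X = X"
    and le: "\<And>h. spectral_function f X
      \<le> spectral_function f (X + (outer_product x h + outer_product h x))"
  obtains V where "V \<in> sym_subdifferential (spectral_function f) X" "V *v x = 0"
proof -
  define L where "L h = outer_product x h + outer_product h x" for h
  have "linear L"
    by (rule linearI) (simp_all add: L_def outer_product_def vec_eq_iff algebra_simps)
  then have "subspace (range L)" by (simp add: linear_subspace_image)
  moreover have "spectral_function f (sym_part X) \<le> spectral_function f (sym_part (X + s))"
    if "s \<in> range L" for s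
    using that le X by (auto simp: L_def sym_part_symmetric add.commute)
  ultimately obtain V where V: "\<And>Y. spectral_function f (sym_part X) + V \<bullet> (Y - X) \<le> spectral_function f (sym_part Y)"
    "\<And>s. s \<in> range L \<Longrightarrow> V \<bullet> s = 0"
    using subgradient_orthogonal_subspace[OF convex_on_spectral_function_sym_part[OF f]] by metis
  have sub: "V \<in> sym_subdifferential (spectral_function f) X"
    by (rule sym_subdifferential_spectral_function[OF X V(1)])
  then have symV: "transpose V = V" by (simp add: sym_subdifferential_def)
  have "h \<bullet> (V *v x) = 0" for h
  proof -
    have "V \<bullet> L h = h \<bullet> (V *v x) + x \<bullet> (V *v h)"
      by (simp add: L_def inner_add_right inner_eq_trace symV matrix_add_ldistrib trace_add trace_mult_outer_product)
    then show ?thesis using V(2)[of "L h"] inner_matrix_symmetric[OF symV, of x h] by simp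
  qed
  from this[of "V *v x"] have "V *v x = 0" by simp
  with sub show thesis by (rule that)
qed

text \<open>Convexity turns the infinitesimal inequality into a global one: the weight
  \<open>t\<close> divides out, and the remaining second-order term disappears as \<open>t\<close>
  tends to 0 from the right.\<close>

lemma frechet_subgradient_bound:
  fixes f :: "real ^ 'n::{finite,linorder} \<Rightarrow> real"
  assumes f: "symmetric_function f" "convex_on UNIV f" and C: "transpose C = C"
    and v: "v \<in> frechet_subdifferential (\<lambda>y. spectral_function f (outer_product y y - C)) y"
  shows "spectral_function f (outer_product y y - C) + v \<bullet> h
    \<le> spectral_function f (outer_product y y - C + (outer_product y h + outer_product h y))"
proof (cases "h = 0")
  case True
  then show ?thesis by (simp add: outer_product_def zero_vec_def[symmetric])
next
  case False
  define g where "g y = spectral_function f (outer_product y y - C)" for y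
  define X where "X = outer_product y y - C"
  define Z where "Z t = X + (outer_product y h + outer_product h y) + t *\<^sub>R outer_product h h" for t
  have symX: "transpose X = X" and symZ: "transpose (Z t) = Z t" for t
    by (simp_all add: X_def Z_def C add.commute transpose_scalar)
  have g_le: "g (y + t *\<^sub>R h) \<le> (1 - t) * g y + t * spectral_function f (Z t)"
    if "0 < t" "t < 1" for t
  proof -
    have "outer_product (y + t *\<^sub>R h) (y + t *\<^sub>R h) - C = (1 - t) *\<^sub>R X + t *\<^sub>R Z t"
      by (simp add: X_def Z_def outer_product_def vec_eq_iff algebra_simps)
    then show ?thesis
      using spectral_function_convex[OF f symX symZ, of t] that by (simp add: g_def X_def)
  qed
  have "(Z \<longlongrightarrow> Z 0) (at_right 0)"
    unfolding Z_def by (intro tendsto_intros)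
  then have lim: "((\<lambda>t. spectral_function f (Z t)) \<longlongrightarrow> spectral_function f (Z 0)) (at_right 0)"
    by (rule tendsto_spectral_function[OF f _ symZ symZ])
  have "g y + v \<bullet> h \<le> spectral_function f (Z 0) + e" if e: "e > 0" for e
  proof -
    \<comment> \<open>The error at \<open>y + t *\<^sub>R h\<close> becomes \<open>t * e\<close>,
      hence \<open>e\<close> after division by \<open>t\<close>.\<close>
    define \<epsilon> where "\<epsilon> = e / norm h"
    have \<epsilon>: "\<epsilon> > 0" "\<epsilon> * norm h = e" using e False by (simp_all add: \<epsilon>_def)
    have ev: "\<forall>\<^sub>F y' in at y. g y + v \<bullet> (y' - y) - \<epsilon> * norm (y' - y) \<le> g y'"
      using v \<epsilon>(1) unfolding frechet_subdifferential_def g_def by blast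
    have "filterlim (\<lambda>t. y + t *\<^sub>R h) (at y) (at_right 0)"
      unfolding filterlim_at
    proof
      show "((\<lambda>t. y + t *\<^sub>R h) \<longlongrightarrow> y) (at_right 0)"
        by (rule tendsto_eq_intros refl | simp)+
      show "\<forall>\<^sub>F t in at_right 0. y + t *\<^sub>R h \<in> UNIV \<and> y + t *\<^sub>R h \<noteq> y"
        using False eventually_at_right_less[of 0] by (auto elim!: eventually_mono)
    qed
    from filterlim_iff[THEN iffD1, rule_format, OF this ev]
    have "\<forall>\<^sub>F t in at_right 0. g y + t * (v \<bullet> h) - \<epsilon> * (\<bar>t\<bar> * norm h) \<le> g (y + t *\<^sub>R h)"
      by simp
    moreover have "\<forall>\<^sub>F t::real in at_right 0. 0 < t \<and> t < 1"
      using eventually_at_right_real[of 0 1] by (auto elim: eventually_mono)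
    ultimately have "\<forall>\<^sub>F t in at_right 0. g y + v \<bullet> h - e \<le> spectral_function f (Z t)"
    proof eventually_elim
      case (elim t)
      have "g y + t * (v \<bullet> h) - \<epsilon> * (t * norm h) \<le> (1 - t) * g y + t * spectral_function f (Z t)"
        using elim g_le[of t] by simp
      then have "t * (g y + v \<bullet> h - e) \<le> t * spectral_function f (Z t)"
        unfolding \<epsilon>(2)[symmetric] by (simp add: algebra_simps)
      then show ?case using elim by simp
    qed
    from tendsto_lowerbound[OF lim this] show ?thesis by simp
  qed
  then have "g y + v \<bullet> h \<le> spectral_function f (Z 0)" by (rule field_le_epsilon)
  then show ?thesis by (simp add: g_def Z_def X_def)
qed

text \<open>The global bound holds at the approximating points for each fixed \<open>h\<close>. Both
  sides converge and \<open>vs\<close> tends to 0, which leaves the hypothesis of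
  \<open>subgradient_annihilating\<close>.\<close>

lemma stationary_imp_subgradient:
  fixes f :: "real ^ 'n::{finite,linorder} \<Rightarrow> real"
  assumes f: "symmetric_function f" "convex_on UNIV f" and C: "transpose C = C"
    and st: "stationary (\<lambda>y. spectral_function f (outer_product y y - C)) x"
  obtains V where "V \<in> sym_subdifferential (spectral_function f) (outer_product x x - C)"
    "V *v x = 0"
proof (rule subgradient_annihilating[OF f])
  show "transpose (outer_product x x - C) = outer_product x x - C" by (simp add: C)
  fix h
  obtain xs vs where xs: "xs \<longlonglongrightarrow> x"
    "(\<lambda>i::nat. spectral_function f (outer_product (xs i) (xs i) - C)) \<longlonglongrightarrow> spectral_function f (outer_product x x - C)"
    and vs: "vs \<longlonglongrightarrow> 0"
    "\<And>i. vs i \<in> frechet_subdifferential (\<lambda>y. spectral_function f (outer_product y y - C)) (xs i)"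
    using st unfolding stationary_def limiting_subdifferential_def by blast
  have "(\<lambda>i. spectral_function f (outer_product (xs i) (xs i) - C) + vs i \<bullet> h)
      \<longlonglongrightarrow> spectral_function f (outer_product x x - C) + 0 \<bullet> h"
    by (intro tendsto_intros xs vs)
  moreover have "(\<lambda>i. spectral_function f (outer_product (xs i) (xs i) - C + (outer_product (xs i) h + outer_product h (xs i))))
      \<longlonglongrightarrow> spectral_function f (outer_product x x - C + (outer_product x h + outer_product h x))"
    unfolding outer_product_def
    by (intro tendsto_spectral_function[OF f] tendsto_intros xs)
      (simp_all add: C outer_product_def[symmetric] add.commute)
  ultimately show "spectral_function f (outer_product x x - C)
      \<le> spectral_function f (outer_product x x - C + (outer_product x h + outer_product h x))"
    using LIMSEQ_le frechet_subgradient_bound[OF f C vs(2)] by fastforce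
qed (rule that)

lemma frechet_subdifferential_imp_stationary:
  assumes "0 \<in> frechet_subdifferential g x"
  shows "stationary g x"
  unfolding stationary_def limiting_subdifferential_def
  using assms by (intro CollectI exI[of _ "\<lambda>_. x"] exI[of _ "\<lambda>_. 0"]) simp

text \<open>Since \<open>V *v x = 0\<close>, the linear term of the subgradient inequality is a
  quadratic form in \<open>y - x\<close>, hence of order \<open>o(norm (y - x))\<close>.\<close>

lemma subgradient_imp_stationary:
  assumes V: "V \<in> sym_subdifferential F (outer_product x x - C)" "V *v x = 0" and C: "transpose C = C"
  shows "stationary (\<lambda>y. F (outer_product y y - C)) x"
proof (rule frechet_subdifferential_imp_stationary, unfold frechet_subdifferential_def, intro CollectI allI impI)
  fix \<epsilon> :: real assume "\<epsilon> > 0"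
  define K where "K = onorm ((*v) V)"
  have bl: "bounded_linear ((*v) V)" by (rule matrix_vector_mul_bounded_linear)
  have K0: "K \<ge> 0" unfolding K_def by (rule onorm_pos_le[OF bl])
  have symV: "transpose V = V" using V(1) by (simp add: sym_subdifferential_def)
  have quad: "F (outer_product x x - C) - K * (norm (y - x))\<^sup>2 \<le> F (outer_product y y - C)" for y
  proof -
    have "F (outer_product x x - C) + trace (V ** (outer_product y y - outer_product x x))
        \<le> F (outer_product y y - C)"
      using V(1) C unfolding sym_subdifferential_def by (auto dest!: spec[of _ "outer_product y y - C"])
    moreover have "trace (V ** (outer_product y y - outer_product x x)) = (y - x) \<bullet> (V *v (y - x))"
      using V(2) inner_matrix_symmetric[OF symV, of x y]
      by (simp add: matrix_diff_ldistrib trace_sub trace_mult_outer_product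
          matrix_vector_mult_diff_distrib inner_diff_left)
    moreover have "\<bar>(y - x) \<bullet> (V *v (y - x))\<bar> \<le> norm (y - x) * (K * norm (y - x))"
      unfolding K_def using onorm[OF bl, of "y - x"]
      by (intro order_trans[OF Cauchy_Schwarz_ineq2] mult_left_mono) auto
    ultimately show ?thesis by (simp add: power2_eq_square algebra_simps)
  qed
  \<comment> \<open>The added 1 covers \<open>K = 0\<close>.\<close>
  have "\<forall>\<^sub>F y in at x. dist y x < \<epsilon> / (K + 1)"
    using \<open>\<epsilon> > 0\<close> K0 by (auto simp: eventually_at intro!: exI[of _ "\<epsilon> / (K + 1)"])
  then show "\<forall>\<^sub>F y in at x. F (outer_product y y - C) \<ge> F (outer_product x x - C) + 0 \<bullet> (y - x) - \<epsilon> * norm (y - x)"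
  proof eventually_elim
    case (elim y)
    have "K * norm (y - x) \<le> (K + 1) * norm (y - x)" by (simp add: mult_right_mono)
    also have "\<dots> \<le> \<epsilon>" using elim K0 by (simp add: dist_norm field_simps)
    finally have "K * norm (y - x) * norm (y - x) \<le> \<epsilon> * norm (y - x)" by (rule mult_right_mono) simp
    with quad[of y] show ?case by (simp add: power2_eq_square)
  qed
qed

text \<open>The first conjunct is the chain rule identifying limiting stationarity with the
  existence of a subgradient that annihilates \<open>x\<close>.\<close>

theorem corollary5p12:
  fixes f :: "real ^ 'n::{finite,linorder} \<Rightarrow> real"
    and xbar :: "real ^ 'n::{finite,linorder}"
    and X :: "real ^ 'n::{finite,linorder} \<Rightarrow> real ^ 'n::{finite,linorder} ^ 'n::{finite,linorder}"
    and g :: "real ^ 'n::{finite,linorder} \<Rightarrow> real"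
  assumes "symmetric_function f"
    and "convex_on UNIV f"
    and "xbar \<noteq> 0"
    and X: "\<And>x. X x = outer_product x x - outer_product xbar xbar"
    and g: "\<And>x. g x = spectral_function f (X x)"
  shows "(\<forall>x. stationary g x \<longleftrightarrow>
            (\<exists>V \<in> sym_subdifferential (spectral_function f) (X x). V *v x = 0))
    \<and> (\<forall>x. \<forall>V \<in> sym_subdifferential (spectral_function f) (X x). V *v x = 0 \<longrightarrow>
            g x \<le> g xbar \<or> x = 0 \<or> (x \<bullet> xbar = 0 \<and> eigvals V $ Min UNIV = 0))
    \<and> ((\<forall>y. g xbar \<le> g y) \<longrightarrow>
        (\<forall>x. stationary g x \<longleftrightarrow>
            g x \<le> g xbar \<or> x = 0 \<or>
            (x \<bullet> xbar = 0 \<and>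
              (\<exists>V \<in> sym_subdifferential (spectral_function f) (X x).
                  eigvals V $ Min UNIV = 0))))"
proof -
  define C where "C = outer_product xbar xbar"
  have C: "transpose C = C" by (simp add: C_def)
  have g_def: "g = (\<lambda>y. spectral_function f (outer_product y y - C))"
    and X_def: "X = (\<lambda>y. outer_product y y - C)"
    by (simp_all add: g X C_def fun_eq_iff)
  have g_xbar: "g xbar = spectral_function f 0" by (simp add: g_def C_def)
  have stationary_iff: "stationary g x \<longleftrightarrow>
      (\<exists>V \<in> sym_subdifferential (spectral_function f) (X x). V *v x = 0)" for x
  proof
    assume "stationary g x"
    from stationary_imp_subgradient[OF assms(1,2) C this[unfolded g_def]]
    show "\<exists>V \<in> sym_subdifferential (spectral_function f) (X x). V *v x = 0"
      unfolding X_def by blast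
  next
    assume "\<exists>V \<in> sym_subdifferential (spectral_function f) (X x). V *v x = 0"
    then show "stationary g x"
      unfolding X_def g_def by (blast intro: subgradient_imp_stationary[OF _ _ C])
  qed
  have trichotomy: "g x \<le> g xbar \<or> x = 0 \<or> (x \<bullet> xbar = 0 \<and> eigvals V $ Min UNIV = 0)"
    if V: "V \<in> sym_subdifferential (spectral_function f) (X x)" and Vx: "V *v x = 0" for V x
  proof -
    have symV: "transpose V = V" using V by (simp add: sym_subdifferential_def)
    have V': "V \<in> sym_subdifferential (spectral_function f) (outer_product x x - outer_product xbar xbar)"
      using V by (simp add: X)
    obtain \<mu> where \<mu>: "V *v xbar = \<mu> *\<^sub>R xbar"
      using spectral_subgradient_eigenvector[OF V' Vx assms(3)] .
    \<comment> \<open>The matrix 0 equals \<open>X xbar\<close>, so testing there compares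
      \<open>g x\<close> with \<open>g xbar\<close>.\<close>
    have "transpose 0 = (0 :: real ^ 'n::{finite,linorder} ^ 'n::{finite,linorder})"
      by (simp add: transpose_def vec_eq_iff)
    then have "spectral_function f (X x) + trace (V ** (0 - X x)) \<le> spectral_function f 0"
      using V unfolding sym_subdifferential_def by blast
    moreover have "trace (V ** (0 - X x)) = \<mu> * (xbar \<bullet> xbar)"
      by (simp add: X matrix_diff_ldistrib trace_sub trace_mult_outer_product Vx \<mu> trace_0[unfolded mat_0])
    ultimately have le: "g x + \<mu> * (xbar \<bullet> xbar) \<le> g xbar"
      unfolding g_xbar g[of x] by simp
    show ?thesis
    proof (cases "\<mu> \<ge> 0 \<or> x = 0")
      case True
      moreover have "g x \<le> g xbar" if "\<mu> \<ge> 0"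
        using le mult_nonneg_nonneg[OF that inner_ge_zero[of xbar]] by linarith
      ultimately show ?thesis by blast
    next
      case False
      then have "\<mu> \<noteq> 0" and x: "x \<noteq> 0" by auto
      have "\<mu> * (x \<bullet> xbar) = 0"
        using inner_matrix_symmetric[OF symV, of x xbar] by (simp add: \<mu> Vx)
      with \<open>\<mu> \<noteq> 0\<close> have orth: "x \<bullet> xbar = 0" by simp
      have "x \<bullet> x > 0" using x by simp
      \<comment> \<open>The vector \<open>x\<close> maximizes the Rayleigh quotient with value 0, so
        \<open>V\<close> is negative semidefinite and its top eigenvalue is 0.\<close>
      have neg: "z \<bullet> (V *v z) \<le> 0" for z
      proof -
        have "(z \<bullet> (V *v z)) * (x \<bullet> x) \<le> 0"
          using spectral_subgradient_Rayleigh_max[OF V' orth x assms(3), of z] by (simp add: Vx)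
        with \<open>x \<bullet> x > 0\<close> show ?thesis by (metis mult_pos_pos not_less)
      qed
      have "0 \<le> eigvals V $ Min UNIV * (x \<bullet> x)"
        using eigvals_Min_Rayleigh(1)[OF symV, of x] by (simp add: Vx)
      then have "0 \<le> eigvals V $ Min UNIV" using \<open>x \<bullet> x > 0\<close> by (metis mult_neg_pos not_less)
      moreover have "eigvals V $ Min UNIV \<le> 0"
        using eigvals_Min_Rayleigh(2)[OF symV] neg by metis
      ultimately show ?thesis using orth by simp
    qed
  qed
  have converse: "stationary g x"
    if min: "\<forall>y. g xbar \<le> g y" and cond: "g x \<le> g xbar \<or> x = 0 \<or> (x \<bullet> xbar = 0 \<and>
      (\<exists>V \<in> sym_subdifferential (spectral_function f) (X x). eigvals V $ Min UNIV = 0))" for x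
  proof -
    consider "g x \<le> g xbar" | "x = 0" | V where "x \<noteq> 0" "x \<bullet> xbar = 0"
      "V \<in> sym_subdifferential (spectral_function f) (X x)" "eigvals V $ Min UNIV = 0"
      using cond by blast
    then show ?thesis
    proof cases
      case 1
      \<comment> \<open>Here \<open>x\<close> is itself a global minimizer.\<close>
      have "g x - \<epsilon> * norm (y - x) \<le> g y" if "\<epsilon> > 0" for \<epsilon> y
      proof -
        have "0 \<le> \<epsilon> * norm (y - x)" using that by simp
        moreover have "g x \<le> g y" using min 1 order_trans by blast
        ultimately show ?thesis by linarith
      qed
      then show ?thesis
        by (intro frechet_subdifferential_imp_stationary) (simp add: frechet_subdifferential_def)
    next
      case 2
      \<comment> \<open>At the origin the tangent directions vanish, and any subgradient annihilates
        0.\<close>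
      have "spectral_function f (X 0)
          \<le> spectral_function f (X 0 + (outer_product 0 h + outer_product h 0))" for h
        by (simp add: outer_product_def zero_vec_def[symmetric])
      moreover have "transpose (X 0) = X 0" by (simp add: X)
      ultimately obtain V where "V \<in> sym_subdifferential (spectral_function f) (X 0)" "V *v 0 = 0"
        using subgradient_annihilating[OF assms(1,2), of "X 0" 0] by blast
      then show ?thesis using 2 stationary_iff by blast
    next
      case 3
      have symV: "transpose V = V" using 3(3) by (simp add: sym_subdifferential_def)
      have neg: "z \<bullet> (V *v z) \<le> 0" for z
        using eigvals_Min_Rayleigh(1)[OF symV, of z] 3(4) by simp
      obtain v where v: "v \<bullet> v = 1" "v \<bullet> (V *v v) = 0"
        using eigvals_Min_Rayleigh(2)[OF symV] 3(4) by auto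
      \<comment> \<open>The form attains 0 at the unit vector \<open>v\<close>, and \<open>x\<close>
        maximizes the Rayleigh quotient.\<close>
      have "0 \<le> x \<bullet> (V *v x)"
        using spectral_subgradient_Rayleigh_max[OF 3(3)[unfolded X] 3(2,1) assms(3), of v] v by simp
      then have "V *v x = 0"
        using kernel_of_Rayleigh_max[OF symV neg] neg[of x] by simp
      then show ?thesis using 3(3) stationary_iff by blast
    qed
  qed
  show ?thesis
    using stationary_iff trichotomy converse by (intro conjI allI impI ballI iffI) blast+
qed

end
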